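(* The class $\mathrm{(pfd)}$ of (isomorphism classes of) pointwise finite-dimensional persistence modules is a set.
   Context: Fix a field $\mathbf{k}$. A persistence module is a functor $M:(\mathbb{R},\le)\to \mathrm{Vect}_{\mathbf{k}}$; persistence modules are considered up to isomorphism. $M$ is pointwise finite dimensional if $M(a)$ is finite dimensional for every $a\in\mathbb{R}$. "Is a set" is as opposed to being a proper class. *)

theory Defs
  imports Complex_Main "Jordan_Normal_Form.Missing_VectorSpace"
begin

text \<open>
  Plain HOL has no proper classes, so the ambient set theory is made explicit. The elements of
  \<^typ>\<open>'v\<close> are the sets of a ZFC universe, the values of type \<^typ>\<open>'v set\<close> are its classes, and
  \<open>elts x\<close> is the class of the members of the set \<open>x\<close>. Separation and replacement are stated for
  arbitrary classes and class functions. Pairing follows from the other axioms, and choice is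
  inherited from HOL.
\<close>

locale zfc_universe =
  fixes elts :: "'v \<Rightarrow> 'v set"
  assumes extensionality: "elts x = elts y \<Longrightarrow> x = y"
    and foundation: "wf {(x, y). x \<in> elts y}"
    and separation: "C \<subseteq> elts x \<Longrightarrow> \<exists>y. elts y = C"
    and replacement: "\<exists>y. elts y = f ` elts x"
    and union: "\<exists>y. elts y = (\<Union>z\<in>elts x. elts z)"
    and powerset: "\<exists>y. elts y = {z. elts z \<subseteq> elts x}"
    and infinity: "\<exists>w. (\<exists>e\<in>elts w. elts e = {}) \<and>
                        (\<forall>y\<in>elts w. \<exists>z\<in>elts w. elts z = insert y (elts y))"

definition is_set :: "('v \<Rightarrow> 'v set) \<Rightarrow> 'v set \<Rightarrow> bool" where
  "is_set elts C \<longleftrightarrow> (\<exists>x. elts x = C)"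

text \<open>
  The same notion for a class whose members are not themselves elements of the universe, such as
  isomorphism classes, which are proper classes: it is a set if the sets of the universe can index
  it bijectively. By replacement this agrees with \<^const>\<open>is_set\<close> on classes \<open>C :: 'v set\<close>.
\<close>

definition forms_set :: "('v \<Rightarrow> 'v set) \<Rightarrow> 'a set \<Rightarrow> bool" where
  "forms_set elts X \<longleftrightarrow> (\<exists>x f. bij_betw f (elts x) X)"

text \<open>
  A functor from the poset of real numbers to vector spaces over \<open>K\<close>; \<open>tr M a b\<close> is the image of
  the arrow \<open>a \<le> b\<close> and is meaningful only for \<open>a \<le> b\<close>, on the carrier of \<open>ob M a\<close>.
\<close>

record 'v pers_data =
  ob :: "real \<Rightarrow> ('v, 'v) module"
  tr :: "real \<Rightarrow> real \<Rightarrow> 'v \<Rightarrow> 'v"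

definition persistence_module :: "('v \<Rightarrow> 'v set) \<Rightarrow> 'v ring \<Rightarrow> 'v pers_data \<Rightarrow> bool" where
  "persistence_module elts K M \<longleftrightarrow>
     (\<forall>a. vectorspace K (ob M a) \<and> is_set elts (carrier (ob M a))) \<and>
     (\<forall>a b. a \<le> b \<longrightarrow> linear_map K (ob M a) (ob M b) (tr M a b)) \<and>
     (\<forall>a. \<forall>x\<in>carrier (ob M a). tr M a a x = x) \<and>
     (\<forall>a b c. a \<le> b \<longrightarrow> b \<le> c \<longrightarrow>
        (\<forall>x\<in>carrier (ob M a). tr M b c (tr M a b x) = tr M a c x))"

definition pointwise_fin_dim :: "'v ring \<Rightarrow> 'v pers_data \<Rightarrow> bool" where
  "pointwise_fin_dim K M \<longleftrightarrow> (\<forall>a. vectorspace.fin_dim K (ob M a))"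

definition nat_transformation ::
    "'v ring \<Rightarrow> 'v pers_data \<Rightarrow> 'v pers_data \<Rightarrow> (real \<Rightarrow> 'v \<Rightarrow> 'v) \<Rightarrow> bool" where
  "nat_transformation K M N \<phi> \<longleftrightarrow>
     (\<forall>a. linear_map K (ob M a) (ob N a) (\<phi> a)) \<and>
     (\<forall>a b. a \<le> b \<longrightarrow>
        (\<forall>x\<in>carrier (ob M a). \<phi> b (tr M a b x) = tr N a b (\<phi> a x)))"

definition pers_isomorphic :: "'v ring \<Rightarrow> 'v pers_data \<Rightarrow> 'v pers_data \<Rightarrow> bool" where
  "pers_isomorphic K M N \<longleftrightarrow>
     (\<exists>\<phi> \<psi>. nat_transformation K M N \<phi> \<and> nat_transformation K N M \<psi> \<and>
        (\<forall>a. \<forall>x\<in>carrier (ob M a). \<psi> a (\<phi> a x) = x) \<and>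
        (\<forall>a. \<forall>y\<in>carrier (ob N a). \<phi> a (\<psi> a y) = y))"

definition iso_rel :: "('v \<Rightarrow> 'v set) \<Rightarrow> 'v ring \<Rightarrow> ('v pers_data \<times> 'v pers_data) set" where
  "iso_rel elts K = {(M, N). persistence_module elts K M \<and> persistence_module elts K N \<and>
                             pers_isomorphic K M N}"

definition pfd :: "('v \<Rightarrow> 'v set) \<Rightarrow> 'v ring \<Rightarrow> 'v pers_data set set" where
  "pfd elts K =
     {M. persistence_module elts K M \<and> pointwise_fin_dim K M} // iso_rel elts K"

end

theory Submission
  imports Defs "HOL-Library.Countable_Set"
begin

unbundle cardinal_syntax

text \<open>
  A finite-dimensional space over the field \<open>K\<close> has at most as many vectors as there are subsets of
  \<open>\<nat> \<times> K\<close>, whatever the dimension. So all the spaces of all pointwise finite-dimensional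
  modules embed into a single set \<open>Z\<close>. Fix such embeddings for one representative \<open>M\<close> of each
  isomorphism class and push the whole structure of \<open>M\<close> forward: the graphs of the additions, of the
  scalar multiplications and of the transition maps become subsets of finite products of
  \<open>\<real>\<close>, \<open>K\<close> and \<open>Z\<close>. Composing one embedding with the inverse of another shows that modules with
  the same pushed-forward structure are isomorphic (\<open>same_graphs_imp_isomorphic\<close>), so there are at
  most as many isomorphism classes as triples of such subsets, and these triples form a set
  (\<open>forms_set_iso_classes\<close>).

  The same argument shows that, for every set \<open>Z\<close>, the persistence modules whose spaces are no
  larger than \<open>Z\<close> form a set up to isomorphism. On the side of set theory, a class forms a set iff
  its cardinality is at most that of some set of the universe (\<open>forms_set_iff_card_le\<close>), so that
  cardinal arithmetic replaces codings of pairs and functions inside the universe.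
\<close>

section \<open>Classes of set size\<close>

context zfc_universe
begin

lemma forms_set_iff_card_le: "forms_set elts X \<longleftrightarrow> (\<exists>x. |X| \<le>o |elts x| )"
proof
  assume "forms_set elts X"
  then obtain x f where "bij_betw f (elts x) X"
    unfolding forms_set_def by blast
  then have "|X| \<le>o |elts x|"
    by (intro surj_imp_ordLeq[of X f]) (simp add: bij_betw_def)
  then show "\<exists>x. |X| \<le>o |elts x|" ..
next
  assume "\<exists>x. |X| \<le>o |elts x|"
  then obtain x f where f: "inj_on f X" "f ` X \<subseteq> elts x"
    unfolding card_of_ordLeq[symmetric] by blast
  then obtain y where "elts y = f ` X"
    using separation by blast
  with f have "bij_betw (inv_into X f) (elts y) X"
    by (simp add: bij_betw_inv_into inj_on_imp_bij_betw)
  then show "forms_set elts X"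
    unfolding forms_set_def by blast
qed

lemma forms_set_card_le:
  assumes "forms_set elts Y" and "|X| \<le>o |Y|"
  shows "forms_set elts X"
proof -
  obtain x where "|Y| \<le>o |elts x|"
    using assms(1) unfolding forms_set_iff_card_le ..
  then have "|X| \<le>o |elts x|"
    by (rule ordLeq_transitive[OF assms(2)])
  then show ?thesis
    unfolding forms_set_iff_card_le ..
qed

lemma forms_set_if_is_set:
  assumes "is_set elts C"
  shows "forms_set elts C"
proof -
  obtain x where "elts x = C"
    using assms unfolding is_set_def ..
  then have "bij_betw id (elts x) C"
    by simp
  then show ?thesis
    unfolding forms_set_def by blast
qed

lemma forms_set_Pow:
  assumes "forms_set elts X"
  shows "forms_set elts (Pow X)"
proof -
  obtain x f where f: "bij_betw f (elts x) X"
    using assms unfolding forms_set_def by blast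
  obtain y where y: "elts y = {z. elts z \<subseteq> elts x}"
    using powerset by blast
  have "Pow X \<subseteq> (\<lambda>z. f ` elts z) ` elts y"
  proof
    fix S assume "S \<in> Pow X"
    then obtain C where C: "C \<subseteq> elts x" "S = f ` C"
      using f unfolding bij_betw_def by (metis PowD subset_imageE)
    then obtain z where "elts z = C"
      using separation by blast
    with C y show "S \<in> (\<lambda>z. f ` elts z) ` elts y"
      by auto
  qed
  then have "|Pow X| \<le>o |elts y|"
    by (rule surj_imp_ordLeq)
  then show ?thesis
    using forms_set_iff_card_le by blast
qed

text \<open>
  Each member \<open>y\<close> of the inductive set lies in another member \<open>y \<union> {y}\<close>; in a finite set this chain
  would close up, against foundation.
\<close>

lemma infinite_set_exists: "\<exists>w. infinite (elts w)"
proof -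
  obtain w e where e: "e \<in> elts w"
    and step: "\<And>y. y \<in> elts w \<Longrightarrow> \<exists>z\<in>elts w. elts z = insert y (elts y)"
    using infinity by blast
  have "infinite (elts w)"
  proof
    assume fin: "finite (elts w)"
    define r where "r = {(x, y). x \<in> elts y} \<inter> elts w \<times> elts w"
    have "finite r"
      unfolding r_def using fin by (simp add: finite_subset[of _ "elts w \<times> elts w"])
    moreover have "wf r"
      unfolding r_def by (rule wf_subset[OF foundation]) blast
    ultimately have "wf (r\<inverse>)"
      by (simp add: finite_acyclic_wf_converse wf_acyclic)
    then obtain y where y: "y \<in> elts w" "\<And>z. (z, y) \<in> r\<inverse> \<Longrightarrow> z \<notin> elts w"
      using e by (rule wfE_min) blast
    then obtain z where z: "z \<in> elts w" "elts z = insert y (elts y)"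
      using step by blast
    then have "(z, y) \<in> r\<inverse>"
      unfolding r_def using y(1) by simp
    with y(2) z(1) show False
      by blast
  qed
  then show ?thesis ..
qed

lemma forms_set_nat: "forms_set elts (UNIV :: nat set)"
  using infinite_set_exists unfolding forms_set_iff_card_le infinite_iff_card_of_nat .

text \<open>A real number is determined by the rationals below it.\<close>

lemma forms_set_real: "forms_set elts (UNIV :: real set)"
proof -
  have "|\<rat> :: real set| \<le>o |UNIV :: nat set|"
    using countable_rat unfolding countable_def card_of_ordLeq[symmetric] by blast
  then have "forms_set elts (\<rat> :: real set)"
    using forms_set_nat forms_set_card_le by blast
  then have "forms_set elts (Pow \<rat> :: real set set)"
    by (rule forms_set_Pow)
  moreover have "inj (\<lambda>x :: real. {q \<in> \<rat>. q < x})"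
  proof (rule linorder_injI)
    fix x y :: real assume "x < y"
    then obtain q where "q \<in> \<rat>" "x < q" "q < y"
      using Rats_dense_in_real by blast
    then have "q \<in> {q \<in> \<rat>. q < y} - {q \<in> \<rat>. q < x}"
      by simp
    then show "{q \<in> \<rat>. q < x} \<noteq> {q \<in> \<rat>. q < y}"
      by blast
  qed
  then have "|UNIV :: real set| \<le>o |Pow \<rat> :: real set set|"
    by (rule card_of_ordLeqI) blast
  ultimately show ?thesis
    by (rule forms_set_card_le)
qed

text \<open>
  Cardinals being comparable, both factors inject into one set of the universe, which may be taken
  infinite; an infinite set is equinumerous with its square.
\<close>

lemma forms_set_Times:
  assumes "forms_set elts X" and "forms_set elts Y"
  shows "forms_set elts (X \<times> Y)"
proof -
  obtain w where w: "infinite (elts w)"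
    using infinite_set_exists ..
  obtain x where x: "|X| \<le>o |elts x|"
    using assms(1) unfolding forms_set_iff_card_le ..
  obtain y where y: "|Y| \<le>o |elts y|"
    using assms(2) unfolding forms_set_iff_card_le ..
  have larger: "\<exists>c. |elts a| \<le>o |elts c| \<and> |elts b| \<le>o |elts c|" for a b
    using ordLeq_total[OF card_of_Well_order card_of_Well_order, of "elts a" "elts b"]
  proof
    assume "|elts a| \<le>o |elts b|"
    then have "|elts a| \<le>o |elts b| \<and> |elts b| \<le>o |elts b|"
      by (simp add: card_of_mono1)
    then show ?thesis ..
  next
    assume "|elts b| \<le>o |elts a|"
    then have "|elts a| \<le>o |elts a| \<and> |elts b| \<le>o |elts a|"
      by (simp add: card_of_mono1)
    then show ?thesis ..
  qed
  obtain a where a: "|elts x| \<le>o |elts a| \<and> |elts y| \<le>o |elts a|"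
    using larger ..
  obtain b where b: "|elts a| \<le>o |elts b| \<and> |elts w| \<le>o |elts b|"
    using larger ..
  have "infinite (elts b)"
    using conjunct2[OF b] w by (rule card_of_ordLeq_infinite)
  moreover have "|X| \<le>o |elts b|"
    by (rule ordLeq_transitive[OF x ordLeq_transitive[OF conjunct1[OF a] conjunct1[OF b]]])
  moreover have "|Y| \<le>o |elts b|"
    by (rule ordLeq_transitive[OF y ordLeq_transitive[OF conjunct2[OF a] conjunct1[OF b]]])
  ultimately have "|X \<times> Y| \<le>o |elts b|"
    by (intro card_of_Times_ordLeq_infinite_Field card_of_Card_order) (simp_all add: Field_card_of)
  then show ?thesis
    using forms_set_iff_card_le by blast
qed

end

section \<open>Isomorphism of persistence modules\<close>

lemma linear_map_iff:
  "linear_map K V W f \<longleftrightarrow> vectorspace K V \<and> vectorspace K W \<and> f \<in> module_hom K V W"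
  unfolding linear_map_def mod_hom_def mod_hom_axioms_def vectorspace_def by blast

lemma persistence_module_closed:
  assumes "persistence_module elts K M"
  shows "x \<in> carrier (ob M a) \<Longrightarrow> y \<in> carrier (ob M a) \<Longrightarrow> x \<oplus>\<^bsub>ob M a\<^esub> y \<in> carrier (ob M a)"
    and "k \<in> carrier K \<Longrightarrow> x \<in> carrier (ob M a) \<Longrightarrow> k \<odot>\<^bsub>ob M a\<^esub> x \<in> carrier (ob M a)"
    and "a \<le> b \<Longrightarrow> x \<in> carrier (ob M a) \<Longrightarrow> tr M a b x \<in> carrier (ob M b)"
proof -
  interpret vectorspace K "ob M a"
    using assms unfolding persistence_module_def by blast
  show "x \<in> carrier (ob M a) \<Longrightarrow> y \<in> carrier (ob M a) \<Longrightarrow> x \<oplus>\<^bsub>ob M a\<^esub> y \<in> carrier (ob M a)"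
    and "k \<in> carrier K \<Longrightarrow> x \<in> carrier (ob M a) \<Longrightarrow> k \<odot>\<^bsub>ob M a\<^esub> x \<in> carrier (ob M a)"
    by simp_all
  show "a \<le> b \<Longrightarrow> x \<in> carrier (ob M a) \<Longrightarrow> tr M a b x \<in> carrier (ob M b)"
    using assms unfolding persistence_module_def linear_map_iff module_hom_def by blast
qed

lemma nat_transformation_comp:
  assumes "nat_transformation K L M \<phi>" and "nat_transformation K M N \<psi>"
  shows "nat_transformation K L N (\<lambda>a x. \<psi> a (\<phi> a x))"
  using assms unfolding nat_transformation_def linear_map_iff module_hom_def by (simp add: Pi_iff)

lemma pers_isomorphic_sym:
  assumes "pers_isomorphic K M N"
  shows "pers_isomorphic K N M"
  using assms unfolding pers_isomorphic_def by blast

lemma pers_isomorphic_trans: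
  assumes "pers_isomorphic K L M" and "pers_isomorphic K M N"
  shows "pers_isomorphic K L N"
proof -
  obtain \<phi> \<phi>' where \<phi>: "nat_transformation K L M \<phi>" "nat_transformation K M L \<phi>'"
    "\<forall>a. \<forall>x\<in>carrier (ob L a). \<phi>' a (\<phi> a x) = x"
    "\<forall>a. \<forall>y\<in>carrier (ob M a). \<phi> a (\<phi>' a y) = y"
    using assms(1) unfolding pers_isomorphic_def by (elim exE conjE)
  obtain \<psi> \<psi>' where \<psi>: "nat_transformation K M N \<psi>" "nat_transformation K N M \<psi>'"
    "\<forall>a. \<forall>x\<in>carrier (ob M a). \<psi>' a (\<psi> a x) = x"
    "\<forall>a. \<forall>y\<in>carrier (ob N a). \<psi> a (\<psi>' a y) = y"
    using assms(2) unfolding pers_isomorphic_def by (elim exE conjE)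
  have "\<forall>a. \<forall>x\<in>carrier (ob L a). \<phi> a x \<in> carrier (ob M a)"
    using \<phi>(1) unfolding nat_transformation_def linear_map_iff module_hom_def Pi_def by simp
  with \<phi>(3) \<psi>(3) have "\<forall>a. \<forall>x\<in>carrier (ob L a). \<phi>' a (\<psi>' a (\<psi> a (\<phi> a x))) = x"
    by simp
  moreover have "\<forall>a. \<forall>y\<in>carrier (ob N a). \<psi>' a y \<in> carrier (ob M a)"
    using \<psi>(2) unfolding nat_transformation_def linear_map_iff module_hom_def Pi_def by simp
  with \<phi>(4) \<psi>(4) have "\<forall>a. \<forall>y\<in>carrier (ob N a). \<psi> a (\<phi> a (\<phi>' a (\<psi>' a y))) = y"
    by simp
  ultimately show ?thesis
    unfolding pers_isomorphic_def
    using nat_transformation_comp[OF \<phi>(1) \<psi>(1)] nat_transformation_comp[OF \<psi>(2) \<phi>(2)]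
    by blast
qed

section \<open>Pushing a module structure forward along embeddings\<close>

definition add_graph :: "(real \<Rightarrow> 'v \<Rightarrow> 'b) \<Rightarrow> 'v pers_data \<Rightarrow> (real \<times> 'b \<times> 'b \<times> 'b) set" where
  "add_graph g M = {(a, g a x, g a y, g a (x \<oplus>\<^bsub>ob M a\<^esub> y)) | a x y.
     x \<in> carrier (ob M a) \<and> y \<in> carrier (ob M a)}"

definition smult_graph ::
    "'v ring \<Rightarrow> (real \<Rightarrow> 'v \<Rightarrow> 'b) \<Rightarrow> 'v pers_data \<Rightarrow> (real \<times> 'v \<times> 'b \<times> 'b) set" where
  "smult_graph K g M = {(a, k, g a x, g a (k \<odot>\<^bsub>ob M a\<^esub> x)) | a k x.
     k \<in> carrier K \<and> x \<in> carrier (ob M a)}"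

definition tr_graph :: "(real \<Rightarrow> 'v \<Rightarrow> 'b) \<Rightarrow> 'v pers_data \<Rightarrow> (real \<times> real \<times> 'b \<times> 'b) set" where
  "tr_graph g M = {(a, b, g a x, g b (tr M a b x)) | a b x.
     a \<le> b \<and> x \<in> carrier (ob M a)}"

text \<open>
  Each of the three graph equations says that the bijection \<open>x \<mapsto> h\<inverse> (g x)\<close> respects one of the
  operations. That this map is defined at all comes from the transition maps \<open>a \<le> a\<close>, whose graph
  records the image of the embedding.
\<close>

lemma same_graphs_imp_nat_transformation:
  assumes M: "persistence_module elts K M" and N: "persistence_module elts K N"
    and inj: "\<And>a. inj_on (h a) (carrier (ob N a))"
    and add: "add_graph g M = add_graph h N"
    and smult: "smult_graph K g M = smult_graph K h N"
    and tr: "tr_graph g M = tr_graph h N"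
  shows "nat_transformation K M N (\<lambda>a x. inv_into (carrier (ob N a)) (h a) (g a x))"
    and "\<And>a x. x \<in> carrier (ob M a) \<Longrightarrow> g a x \<in> h a ` carrier (ob N a)"
proof -
  let ?\<phi> = "\<lambda>a x. inv_into (carrier (ob N a)) (h a) (g a x)"
  show range: "g a x \<in> h a ` carrier (ob N a)" if "x \<in> carrier (ob M a)" for a x
  proof -
    have "(a, a, g a x, g a (tr M a a x)) \<in> tr_graph g M"
      unfolding tr_graph_def using that by blast
    then show ?thesis
      unfolding tr unfolding tr_graph_def by blast
  qed
  have \<phi>_eq: "?\<phi> a x = y" if "y \<in> carrier (ob N a)" "g a x = h a y" for a x y
    using that inj by simp
  have vs: "vectorspace K (ob M a)" "vectorspace K (ob N a)" for a
    using M N unfolding persistence_module_def by blast+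
  note N_closed = persistence_module_closed[OF N]
  have "?\<phi> a \<in> module_hom K (ob M a) (ob N a)" for a
    unfolding module_hom_def
  proof (intro CollectI conjI allI impI; (elim conjE)?)
    show "?\<phi> a \<in> carrier (ob M a) \<rightarrow> carrier (ob N a)"
      using range by (auto intro: inv_into_into)
  next
    fix x y assume "x \<in> carrier (ob M a)" "y \<in> carrier (ob M a)"
    then have "(a, g a x, g a y, g a (x \<oplus>\<^bsub>ob M a\<^esub> y)) \<in> add_graph h N"
      unfolding add[symmetric] unfolding add_graph_def by blast
    then obtain x' y' where "x' \<in> carrier (ob N a)" "y' \<in> carrier (ob N a)"
      "g a x = h a x'" "g a y = h a y'" "g a (x \<oplus>\<^bsub>ob M a\<^esub> y) = h a (x' \<oplus>\<^bsub>ob N a\<^esub> y')"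
      unfolding add_graph_def by blast
    then show "?\<phi> a (x \<oplus>\<^bsub>ob M a\<^esub> y) = ?\<phi> a x \<oplus>\<^bsub>ob N a\<^esub> ?\<phi> a y"
      using \<phi>_eq N_closed(1) by metis
  next
    fix k x assume k: "k \<in> carrier K" and "x \<in> carrier (ob M a)"
    then have "(a, k, g a x, g a (k \<odot>\<^bsub>ob M a\<^esub> x)) \<in> smult_graph K h N"
      unfolding smult[symmetric] unfolding smult_graph_def by blast
    then obtain x' where "x' \<in> carrier (ob N a)"
      "g a x = h a x'" "g a (k \<odot>\<^bsub>ob M a\<^esub> x) = h a (k \<odot>\<^bsub>ob N a\<^esub> x')"
      unfolding smult_graph_def by blast
    then show "?\<phi> a (k \<odot>\<^bsub>ob M a\<^esub> x) = k \<odot>\<^bsub>ob N a\<^esub> ?\<phi> a x"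
      using \<phi>_eq N_closed(2) k by metis
  qed
  moreover have "?\<phi> b (tr M a b x) = tr N a b (?\<phi> a x)"
    if "a \<le> b" "x \<in> carrier (ob M a)" for a b x
  proof -
    have "(a, b, g a x, g b (tr M a b x)) \<in> tr_graph h N"
      unfolding tr[symmetric] unfolding tr_graph_def using that by blast
    then obtain x' where x': "x' \<in> carrier (ob N a)"
      "g a x = h a x'" "g b (tr M a b x) = h b (tr N a b x')"
      unfolding tr_graph_def by blast
    moreover have "tr N a b x' \<in> carrier (ob N b)"
      using N_closed(3) x'(1) \<open>a \<le> b\<close> by blast
    ultimately show ?thesis
      using \<phi>_eq by metis
  qed
  ultimately show "nat_transformation K M N ?\<phi>"
    using vs unfolding nat_transformation_def linear_map_iff by blast
qed

lemma same_graphs_imp_isomorphic: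
  assumes M: "persistence_module elts K M" and N: "persistence_module elts K N"
    and g: "\<And>a. inj_on (g a) (carrier (ob M a))"
    and h: "\<And>a. inj_on (h a) (carrier (ob N a))"
    and graphs: "add_graph g M = add_graph h N" "smult_graph K g M = smult_graph K h N"
      "tr_graph g M = tr_graph h N"
  shows "pers_isomorphic K M N"
proof -
  note to_N = same_graphs_imp_nat_transformation[OF M N h graphs]
  note to_M = same_graphs_imp_nat_transformation[OF N M g graphs[symmetric]]
  show ?thesis
    unfolding pers_isomorphic_def
    using to_N to_M g h
    by (intro exI[of _ "\<lambda>a x. inv_into (carrier (ob N a)) (h a) (g a x)"]
        exI[of _ "\<lambda>a y. inv_into (carrier (ob M a)) (g a) (h a y)"]) (simp add: f_inv_into_f)
qed

section \<open>Isomorphism classes of modules of bounded size\<close>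

text \<open>
  A class is coded by the graphs of one of its members. Isomorphic modules may well have different
  codes, since their embeddings into \<open>Z\<close> are unrelated; hence the choice of a representative. Only
  the injectivity of the resulting code matters, not which triples of graphs occur.
\<close>

lemma (in zfc_universe) forms_set_iso_classes:
  assumes K: "forms_set elts (carrier K)" and Z: "forms_set elts Z"
    and P: "\<And>M. M \<in> P \<Longrightarrow> persistence_module elts K M"
    and bound: "\<And>M a. M \<in> P \<Longrightarrow> |carrier (ob M a)| \<le>o |Z|"
  shows "forms_set elts (P // iso_rel elts K)"
proof -
  define cls where "cls M = iso_rel elts K `` {M}" for M
  have quotient: "P // iso_rel elts K = cls ` P"
    unfolding quotient_def cls_def by blast
  define rep where "rep = inv_into P cls"
  have rep: "rep X \<in> P" "cls (rep X) = X" if "X \<in> cls ` P" for X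
    using that unfolding rep_def by (simp_all add: inv_into_into f_inv_into_f)
  have "\<exists>f. inj_on f (carrier (ob M a)) \<and> f ` carrier (ob M a) \<subseteq> Z" if "M \<in> P" for M a
    using bound[OF that] unfolding card_of_ordLeq[symmetric] .
  then obtain g where g: "\<And>M a. M \<in> P \<Longrightarrow> inj_on (g M a) (carrier (ob M a))"
    "\<And>M a. M \<in> P \<Longrightarrow> g M a ` carrier (ob M a) \<subseteq> Z"
    by metis
  define code where "code M = (add_graph (g M) M, smult_graph K (g M) M, tr_graph (g M) M)" for M
  let ?C = "Pow ((UNIV :: real set) \<times> Z \<times> Z \<times> Z) \<times> Pow ((UNIV :: real set) \<times> carrier K \<times> Z \<times> Z)
    \<times> Pow ((UNIV :: real set) \<times> (UNIV :: real set) \<times> Z \<times> Z)"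
  have code_in: "code M \<in> ?C" if "M \<in> P" for M
  proof -
    have gZ: "g M a x \<in> Z" if "x \<in> carrier (ob M a)" for a x
      using g(2)[OF \<open>M \<in> P\<close>] that by blast
    show ?thesis
      using persistence_module_closed[OF P[OF \<open>M \<in> P\<close>]]
      unfolding code_def add_graph_def smult_graph_def tr_graph_def by (auto intro!: gZ)
  qed
  have cls_eqI: "cls M = cls N" if "M \<in> P" "N \<in> P" "code M = code N" for M N
  proof -
    have "pers_isomorphic K M N"
      using that P g(1) unfolding code_def
      by (intro same_graphs_imp_isomorphic[of elts K M N "g M" "g N"]) simp_all
    then show ?thesis
      using P that(1,2) pers_isomorphic_sym pers_isomorphic_trans
      unfolding cls_def iso_rel_def by blast
  qed
  have "|cls ` P| \<le>o |?C|"
  proof (rule card_of_ordLeqI)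
    show "inj_on (code \<circ> rep) (cls ` P)"
      by (rule inj_onI) (metis cls_eqI comp_apply rep)
    show "(code \<circ> rep) X \<in> ?C" if "X \<in> cls ` P" for X
      using code_in rep(1)[OF that] by (simp only: comp_apply)
  qed
  moreover have "forms_set elts ?C"
    by (intro forms_set_Times forms_set_Pow forms_set_real K Z)
  ultimately show ?thesis
    unfolding quotient by (metis forms_set_card_le)
qed

section \<open>The size of a finite-dimensional space\<close>

text \<open>
  Number the elements of a finite spanning set; a vector is then recovered from the graph of its
  coefficients, a subset of \<open>\<nat> \<times> K\<close>. Using natural numbers as indices makes the bound independent
  of the space.
\<close>

lemma (in vectorspace) card_fin_dim_le:
  assumes fin_dim
  shows "|carrier V| \<le>o |Pow ((UNIV :: nat set) \<times> carrier K)|"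
proof -
  obtain B where B: "finite B" "B \<subseteq> carrier V" "span B = carrier V"
    using assms unfolding fin_dim_def by (elim exE conjE)
  have "\<exists>n :: 'c \<Rightarrow> nat. inj_on n B"
    using countable_finite[OF B(1)] unfolding countable_def .
  then obtain n :: "'c \<Rightarrow> nat" where n: "inj_on n B" ..
  define vec where "vec R = lincomb (\<lambda>b. THE k. (n b, k) \<in> R) B" for R
  have "carrier V \<subseteq> vec ` Pow (UNIV \<times> carrier K)"
  proof
    fix v assume "v \<in> carrier V"
    then obtain c where c: "c \<in> B \<rightarrow> carrier K" "lincomb c B = v"
      using finite_in_span[OF B(1,2)] B(3) by metis
    define R where "R = (\<lambda>b. (n b, c b)) ` B"
    have "(THE k. (n b, k) \<in> R) = c b" if "b \<in> B" for b
      using n that unfolding R_def by (intro the_equality) (auto dest: inj_onD)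
    then have "vec R = lincomb c B"
      unfolding vec_def lincomb_def using B(2) c(1)
      by (intro finsum_cong') (auto simp: Pi_iff)
    moreover have "R \<in> Pow (UNIV \<times> carrier K)"
      unfolding R_def using c(1) by blast
    ultimately show "v \<in> vec ` Pow (UNIV \<times> carrier K)"
      using c(2) by (intro image_eqI[of v vec R]) simp_all
  qed
  then show ?thesis
    by (rule surj_imp_ordLeq)
qed

theorem proposition3p25:
  fixes elts :: "'v \<Rightarrow> 'v set" and K :: "'v ring"
  assumes "zfc_universe elts"
    and "field K" and "is_set elts (carrier K)"
  shows "forms_set elts (pfd elts K)"
proof -
  interpret zfc_universe elts by (rule assms)
  have K: "forms_set elts (carrier K)"
    using assms(3) by (rule forms_set_if_is_set)
  then have "forms_set elts (Pow ((UNIV :: nat set) \<times> carrier K))"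
    by (intro forms_set_Pow forms_set_Times forms_set_nat)
  with K show ?thesis
    unfolding pfd_def
  proof (rule forms_set_iso_classes)
    fix M a assume "M \<in> {M. persistence_module elts K M \<and> pointwise_fin_dim K M}"
    then show "|carrier (ob M a)| \<le>o |Pow ((UNIV :: nat set) \<times> carrier K)|"
      unfolding persistence_module_def pointwise_fin_dim_def
      by (blast intro: vectorspace.card_fin_dim_le)
  qed blast
qed

end
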